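(* If $G$ is a regular nonbipartite graph of order $n$ and diameter $D$, then \[ \mu(G)+\mu_{\min}(G)>\frac{1}{nD}. \]
   Context: All graphs are finite and simple. For a graph $F$, $\mu(F)$ and $\mu_{\min}(F)$ denote the largest and smallest eigenvalues of the adjacency matrix of $F$. A graph of diameter $D$ is connected, and $D$ is the maximum over pairs of vertices of the length of a shortest path joining them. *)

theory Defs
  imports
    "Graph_Theory.Digraph_Component"
    "Jordan_Normal_Form.Spectral_Radius"
begin

text \<open>
  A finite simple graph is a digraph satisfying the locale predicate \<^term>\<open>graph\<close>: finite, loopless,
  without parallel arcs, and with a symmetric arc relation.  Each undirected edge is thus
  represented by two opposite arcs, so the degree of a vertex is its out-degree, and the length
  of an undirected path is the number of arcs of the corresponding directed path.
\<close>

definition regular_graph :: "('a, 'b) pre_digraph \<Rightarrow> bool" where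
  "regular_graph G \<longleftrightarrow> (\<exists>d. \<forall>v\<in>verts G. out_degree G v = d)"

text \<open>One of the two classes may be empty, so a single vertex is a bipartite graph.\<close>

definition bipartite_graph :: "('a, 'b) pre_digraph \<Rightarrow> bool" where
  "bipartite_graph G \<longleftrightarrow>
    (\<exists>U W. U \<union> W = verts G \<and> U \<inter> W = {} \<and>
      (\<forall>e\<in>arcs G. tail G e \<in> U \<and> head G e \<in> W \<or> tail G e \<in> W \<and> head G e \<in> U))"

text \<open>The following is meaningful only if some path joins \<open>u\<close> to \<open>v\<close>.\<close>

definition path_distance :: "('a, 'b) pre_digraph \<Rightarrow> 'a \<Rightarrow> 'a \<Rightarrow> nat" where
  "path_distance G u v = (LEAST k. \<exists>p. pre_digraph.apath G u p v \<and> length p = k)"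

definition has_diameter :: "('a, 'b) pre_digraph \<Rightarrow> nat \<Rightarrow> bool" where
  "has_diameter G D \<longleftrightarrow>
    Digraph_Component.connected G \<and>
    D = Max {path_distance G u v | u v. u \<in> verts G \<and> v \<in> verts G}"

text \<open>
  A matrix needs its rows and columns to be numbered, so the adjacency matrix is taken with
  respect to a list \<open>vs\<close> enumerating the vertices.  A different enumeration conjugates the matrix
  by a permutation matrix and leaves the eigenvalues unchanged.
\<close>

definition vertex_enumeration :: "('a, 'b) pre_digraph \<Rightarrow> 'a list \<Rightarrow> bool" where
  "vertex_enumeration G vs \<longleftrightarrow> distinct vs \<and> set vs = verts G"

definition adjacency_matrix :: "('a, 'b) pre_digraph \<Rightarrow> 'a list \<Rightarrow> real mat" where
  "adjacency_matrix G vs =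
    mat (length vs) (length vs) (\<lambda>(i, j). if vs ! i \<rightarrow>\<^bsub>G\<^esub> vs ! j then 1 else 0)"

text \<open>
  The adjacency matrix is real symmetric, so all its eigenvalues are real and the real
  \<^const>\<open>spectrum\<close> contains all of them.
\<close>

definition max_eigenvalue :: "real mat \<Rightarrow> real" where
  "max_eigenvalue A = Max (spectrum A)"

definition min_eigenvalue :: "real mat \<Rightarrow> real" where
  "min_eigenvalue A = Min (spectrum A)"

end

theory Submission
  imports Defs
begin

text \<open>
  Let \<open>d\<close> be the degree, \<open>x\<close> an eigenvector of \<open>\<mu>\<^sub>m\<^sub>i\<^sub>n\<close> and \<open>w\<close> a vertex at which \<open>\<bar>x\<bar>\<close> is
  maximal. Then \<open>(d + \<mu>\<^sub>m\<^sub>i\<^sub>n) \<parallel>x\<parallel>\<^sup>2\<close> is the sum of \<open>(x\<^sub>u + x\<^sub>v)\<^sup>2\<close> over the edges. As the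
  graph is not bipartite, some edge joins two vertices at the same distance \<open>k\<close> from \<open>w\<close>, and
  \<open>1 \<le> k \<le> D\<close>. With geodesics from \<open>w\<close> to its ends it forms an odd closed walk, along which the
  alternating sum of the \<open>x\<^sub>u + x\<^sub>v\<close> is \<open>2 x\<^sub>w\<close>. The geodesics may share edges, but not the last
  one, so the squares of the multiplicities in the walk add up to at most
  \<open>4 (k - 1) + 2 + 1 = 4 k - 1\<close>. Cauchy-Schwarz now gives
  \<open>(d + \<mu>\<^sub>m\<^sub>i\<^sub>n) \<parallel>x\<parallel>\<^sup>2 \<ge> 4 x\<^sub>w\<^sup>2 / (4 k - 1) > x\<^sub>w\<^sup>2 / D \<ge> \<parallel>x\<parallel>\<^sup>2 / (n D)\<close>.
\<close>

section \<open>Cauchy-Schwarz along an odd closed walk\<close>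

text \<open>Cauchy-Schwarz in a form that can be iterated: \<open>a\<close> and \<open>b\<close>
  stand for sums of squared coefficients, \<open>P\<close> and \<open>Q\<close> for sums of squares,
  and joining two pieces of a walk adds both factors. The cross term is bounded by AM-GM for
  \<open>a * Q\<close> and \<open>b * P\<close>.\<close>

lemma weighted_Cauchy_Schwarz_two:
  fixes p q a b P Q :: real
  assumes "p\<^sup>2 \<le> a * P" "q\<^sup>2 \<le> b * Q" "0 \<le> a" "0 \<le> b" "0 \<le> P" "0 \<le> Q"
  shows "(p + q)\<^sup>2 \<le> (a + b) * (P + Q)"
proof -
  have "(2 * p * q)\<^sup>2 = 4 * (p\<^sup>2 * q\<^sup>2)"
    by (simp add: power_mult_distrib)
  also have "\<dots> \<le> 4 * ((a * P) * (b * Q))"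
    using assms by (intro mult_left_mono mult_mono) auto
  also have "\<dots> \<le> (a * Q + b * P)\<^sup>2"
    using zero_le_power2[of "a * Q - b * P"] by (simp add: power2_eq_square algebra_simps)
  finally have "2 * p * q \<le> a * Q + b * P"
    by (rule power2_le_imp_le) (use assms(3-6) in simp)
  then show ?thesis
    using assms(1,2) by (simp add: power2_eq_square algebra_simps)
qed

lemma square_add_le:
  fixes u v :: "'a :: linordered_idom"
  shows "(u + v)\<^sup>2 \<le> 2 * (u\<^sup>2 + v\<^sup>2)"
  using zero_le_power2[of "u - v"] by (simp add: power2_eq_square algebra_simps)

text \<open>
  Here \<open>l\<close> is a distance from \<open>w\<close>, the sequences \<open>f\<close> and \<open>g\<close> are geodesics from \<open>w\<close>, and the
  sum on the right counts every edge in both directions.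
\<close>
lemma odd_walk_edge_sum:
  fixes x :: "'a \<Rightarrow> real" and l :: "'a \<Rightarrow> nat" and f g :: "nat \<Rightarrow> 'a"
  assumes E: "finite E" "sym E"
    and k: "k > 0"
    and start: "f 0 = w" "g 0 = w"
    and lf: "\<And>i. i \<le> k \<Longrightarrow> l (f i) = i" and lg: "\<And>i. i \<le> k \<Longrightarrow> l (g i) = i"
    and Ef: "\<And>i. i < k \<Longrightarrow> (f i, f (Suc i)) \<in> E" and Eg: "\<And>i. i < k \<Longrightarrow> (g i, g (Suc i)) \<in> E"
    and last: "(f k, g k) \<in> E" "f k \<noteq> g k"
  shows "8 * (x w)\<^sup>2 \<le> (4 * real k - 1) * (\<Sum>(u, v)\<in>E. (x u + x v)\<^sup>2)"
proof -
  define h where "h = (\<lambda>(u, v). (x u + x v)\<^sup>2)"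
  \<comment> \<open>The two geodesics are followed in parallel. \<open>F i\<close> is a set, so an
    edge shared by both enters \<open>sum h (F i)\<close> only once.\<close>
  define F where "F i = {(f i, f (Suc i)), (g i, g (Suc i))}" for i
  define z where "z i = x (f i) + x (g i)" for i
  define S where "S m = (\<Sum>i<m. sum h (F i))" for m
  have h_nonneg: "h e \<ge> 0" for e
    by (auto simp: h_def split: prod.split)
  have F_nonneg: "sum h (F i) \<ge> 0" for i
    by (intro sum_nonneg h_nonneg)
  have S_nonneg: "S m \<ge> 0" for m
    unfolding S_def by (intro sum_nonneg F_nonneg)
  \<comment> \<open>Two different edges with coefficient 1 each cost 1 + 1 = 2. A shared edge has
    coefficient 2 and costs 4, hence the constant in \<open>any_edges\<close>.\<close>
  have distinct_edges: "(z i + z (Suc i))\<^sup>2 \<le> 2 * sum h (F i)"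
    if "(f i, f (Suc i)) \<noteq> (g i, g (Suc i))" for i
    using square_add_le[of "x (f i) + x (f (Suc i))" "x (g i) + x (g (Suc i))"] that
    by (auto simp: z_def F_def h_def algebra_simps)
  have any_edges: "(z i + z (Suc i))\<^sup>2 \<le> 4 * sum h (F i)" for i
  proof (cases "(f i, f (Suc i)) = (g i, g (Suc i))")
    case True
    then show ?thesis
      by (simp add: z_def F_def h_def power2_eq_square algebra_simps)
  next
    case False
    then show ?thesis
      using distinct_edges[OF False] F_nonneg[of i] by linarith
  qed
  \<comment> \<open>Since \<open>z 0 = 2 * x w\<close>, the left side is the square of the
    telescoped alternating sum of the \<open>z i + z (Suc i)\<close> with \<open>i < m\<close>; each
    level costs at most 4.\<close>
  have partial: "(2 * x w - (- 1) ^ m * z m)\<^sup>2 \<le> (4 * real m) * S m" for m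
  proof (induction m)
    case 0
    then show ?case by (simp add: z_def start)
  next
    case (Suc m)
    have "((- 1) ^ m * (z m + z (Suc m)))\<^sup>2 \<le> 4 * sum h (F m)"
      using any_edges[of m] by (simp add: power_mult_distrib flip: power_mult)
    from weighted_Cauchy_Schwarz_two[OF Suc.IH this] S_nonneg[of m] F_nonneg[of m]
    show ?case by (simp add: S_def algebra_simps)
  qed
  obtain j where j: "k = Suc j"
    using k by (cases k) auto
  have walk: "4 * (x w)\<^sup>2 \<le> (4 * real k - 1) * (S k + h (f k, g k))"
  proof -
    \<comment> \<open>The last edges of the geodesics differ because their ends \<open>f k\<close>
      and \<open>g k\<close> do, so this level costs 2. With 1 for the closing edge the total stays
      below \<open>4 * k\<close>, which later yields strictness.\<close>
    have "((- 1) ^ j * (z j + z (Suc j)))\<^sup>2 \<le> 2 * sum h (F j)"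
      using distinct_edges[of j] last by (simp add: j power_mult_distrib flip: power_mult)
    from weighted_Cauchy_Schwarz_two[OF partial[of j] this] S_nonneg[of j] F_nonneg[of j]
    have 1: "(2 * x w - (- 1) ^ k * z k)\<^sup>2 \<le> (4 * real j + 2) * S k"
      by (simp add: S_def j algebra_simps)
    have 2: "((- 1) ^ k * z k)\<^sup>2 \<le> 1 * h (f k, g k)"
      by (simp add: z_def h_def power_mult_distrib flip: power_mult)
    from weighted_Cauchy_Schwarz_two[OF 1 2] S_nonneg[of k] h_nonneg
    show ?thesis by (simp add: j power2_eq_square algebra_simps)
  qed
  \<comment> \<open>Arcs leading away from \<open>w\<close>, their reversals, and the closing edge
    in both directions: \<open>l\<close> rises, falls or stays constant along them, so the three
    sets are disjoint. Every edge is counted twice.\<close>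
  define U where "U = (\<Union>i<k. F i)"
  define W where "W = {(f k, g k), (g k, f k)}"
  have U_layers: "l v = Suc (l u)" if "(u, v) \<in> U" for u v
    using that lf lg by (auto simp: U_def F_def)
  have W_layers: "l v = l u" if "(u, v) \<in> W" for u v
    using that lf lg by (auto simp: W_def)
  have finite: "finite U" "finite (U\<inverse>)" "finite W"
    by (auto simp: U_def F_def W_def)
  have disjoint: "U \<inter> U\<inverse> = {}" "(U \<union> U\<inverse>) \<inter> W = {}"
    by (auto dest!: U_layers W_layers)
  have "sum h U = S k"
    unfolding U_def S_def
  proof (rule sum.UNION_disjoint)
    \<comment> \<open>Arcs in \<open>F i\<close> start at level \<open>i\<close>.\<close>
    show "\<forall>i\<in>{..<k}. \<forall>j\<in>{..<k}. i \<noteq> j \<longrightarrow> F i \<inter> F j = {}"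
      using lf lg by (fastforce simp: F_def dest: arg_cong[where f = l])
  qed (auto simp: F_def)
  moreover have "sum h (U\<inverse>) = sum h U"
    by (rule sum.reindex_bij_witness[of _ prod.swap prod.swap])
      (auto simp: h_def add.commute)
  moreover have "sum h W = 2 * h (f k, g k)"
    using last by (simp add: W_def h_def add.commute)
  moreover have "sum h (U \<union> U\<inverse> \<union> W) = sum h U + sum h (U\<inverse>) + sum h W"
    using finite disjoint by (simp add: sum.union_disjoint)
  moreover have "sum h (U \<union> U\<inverse> \<union> W) \<le> sum h E"
    using E Ef Eg last h_nonneg
    by (intro sum_mono2) (auto simp: U_def F_def W_def dest: symD)
  ultimately have "2 * (S k + h (f k, g k)) \<le> sum h E"
    by simp
  then have "(4 * real k - 1) * (2 * (S k + h (f k, g k))) \<le> (4 * real k - 1) * sum h E"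
    using k by (intro mult_left_mono) auto
  moreover have "8 * (x w)\<^sup>2 \<le> (4 * real k - 1) * (2 * (S k + h (f k, g k)))"
    using walk by (simp add: algebra_simps)
  ultimately show ?thesis
    by (simp add: h_def)
qed

section \<open>Distances and geodesics\<close>

context graph
begin

text \<open>The minimum in \<open>path_distance\<close> ranges over paths without repeated vertices;
  cutting cycles out of a walk only shortens it.\<close>

lemma path_distance_le_length:
  assumes "awalk u p v"
  shows "path_distance G u v \<le> length p"
  using assms
proof (induction rule: awalk_to_apath_induct)
  case (path p)
  then show ?case
    unfolding path_distance_def by (intro Least_le) (auto simp: apath_def)
next
  case (decomp p q r s)
  then have "length (q @ s) \<le> length p"
    by (auto elim: awalk_cyc_decompE)
  with decomp show ?case by linarith
qed

lemma shortest_apath: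
  assumes "u \<rightarrow>\<^sup>* v"
  obtains p where "apath u p v" "length p = path_distance G u v"
proof -
  from assms obtain p where "apath u p v"
    by (auto simp: reachable_apath)
  then have "\<exists>p. apath u p v \<and> length p = path_distance G u v"
    using LeastI_ex[of "\<lambda>k. \<exists>p. apath u p v \<and> length p = k"]
    unfolding path_distance_def by blast
  with that show ?thesis by blast
qed

lemma path_distance_step:
  assumes "w \<rightarrow>\<^sup>* u" "u \<rightarrow> v"
  shows "path_distance G w v \<le> Suc (path_distance G w u)"
proof -
  from assms(1) obtain p where p: "apath w p u" "length p = path_distance G w u"
    by (rule shortest_apath)
  from assms(2) obtain e where e: "e \<in> arcs G" "tail G e = u" "head G e = v"
    by (rule reachableE)
  have "awalk w (p @ [e]) v"
    using p e by (auto simp: apath_def intro: awalk_appendI arc_implies_awalk)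
  from path_distance_le_length[OF this] p show ?thesis
    by simp
qed

text \<open>The last but one vertex of a shortest path serves: the path without its last arc bounds
  its distance by \<open>k\<close>, and \<open>path_distance_step\<close> excludes a smaller
  value.\<close>

lemma path_distance_predecessor:
  assumes "w \<rightarrow>\<^sup>* v" "path_distance G w v = Suc k"
  obtains u where "w \<rightarrow>\<^sup>* u" "u \<rightarrow> v" "path_distance G w u = k"
proof -
  from assms obtain p where p: "apath w p v" "length p = Suc k"
    by (metis shortest_apath)
  then obtain q e where q: "p = q @ [e]" "length q = k"
    by (metis length_Suc_conv_rev)
  with p have walk: "awalk w q (tail G e)" and e: "e \<in> arcs G" "head G e = v"
    by (auto simp: apath_def awalk_simps)
  have reach: "w \<rightarrow>\<^sup>* tail G e"
    using walk by (rule reachable_awalkI)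
  have arc: "tail G e \<rightarrow> v"
    using e by (auto simp: arcs_ends_conv)
  have "path_distance G w (tail G e) = k"
    using path_distance_le_length[OF walk] path_distance_step[OF reach arc] q(2) assms(2)
    by simp
  with that reach arc show ?thesis by blast
qed

lemma geodesic:
  assumes "w \<rightarrow>\<^sup>* v" "path_distance G w v = k"
  shows "\<exists>f. f 0 = w \<and> f k = v \<and> (\<forall>i\<le>k. path_distance G w (f i) = i) \<and>
    (\<forall>i<k. f i \<rightarrow> f (Suc i))"
  using assms
proof (induction k arbitrary: v)
  case 0
  then obtain p where "apath w p v" "length p = 0"
    by (metis shortest_apath)
  then have "w = v"
    by (simp add: apath_Nil_iff)
  with 0 show ?case
    by (intro exI[of _ "\<lambda>_. w"]) auto
next
  case (Suc k)
  then obtain u where u: "w \<rightarrow>\<^sup>* u" "u \<rightarrow> v" "path_distance G w u = k"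
    by (metis path_distance_predecessor)
  from Suc.IH[OF u(1,3)] obtain f where f: "f 0 = w" "f k = u"
    "\<forall>i\<le>k. path_distance G w (f i) = i" "\<forall>i<k. f i \<rightarrow> f (Suc i)"
    by blast
  show ?case
    using f u Suc.prems
    by (intro exI[of _ "f(Suc k := v)"]) (auto simp: le_Suc_eq less_Suc_eq)
qed

section \<open>Odd closed walks in a nonbipartite graph of given diameter\<close>

text \<open>Distances of adjacent vertices from \<open>w\<close> differ by at most 1. If they never
  agreed, the parity of the distance would be a proper 2-colouring.\<close>

lemma arc_within_layer:
  assumes "\<not> bipartite_graph G" "w \<in> verts G" "\<And>v. v \<in> verts G \<Longrightarrow> w \<rightarrow>\<^sup>* v"
  obtains u v where "u \<rightarrow> v" "path_distance G w u = path_distance G w v"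
proof (rule ccontr)
  assume "\<not> thesis"
  then have no: "path_distance G w u \<noteq> path_distance G w v" if "u \<rightarrow> v" for u v
    using that \<open>\<And>u v. u \<rightarrow> v \<Longrightarrow> path_distance G w u = path_distance G w v \<Longrightarrow> thesis\<close> by blast
  let ?U = "{v \<in> verts G. even (path_distance G w v)}"
  let ?W = "{v \<in> verts G. odd (path_distance G w v)}"
  have "tail G e \<in> ?U \<and> head G e \<in> ?W \<or> tail G e \<in> ?W \<and> head G e \<in> ?U" if "e \<in> arcs G" for e
  proof -
    have arc: "tail G e \<rightarrow> head G e"
      using that by (auto simp: arcs_ends_conv)
    then have arc': "head G e \<rightarrow> tail G e"
      using sym_arcs by (blast dest: arcs_ends_symmetric)
    have "path_distance G w (head G e) = Suc (path_distance G w (tail G e)) \<or>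
      path_distance G w (tail G e) = Suc (path_distance G w (head G e))"
      using path_distance_step[OF assms(3) arc] path_distance_step[OF assms(3) arc'] no[OF arc] that
      by simp linarith
    with that show ?thesis by auto
  qed
  then have "bipartite_graph G"
    unfolding bipartite_graph_def by (intro exI[of _ ?U] exI[of _ ?W]) auto
  with assms(1) show False ..
qed

lemma path_distance_le_diameter:
  assumes "has_diameter G D" "u \<in> verts G" "v \<in> verts G"
  shows "path_distance G u v \<le> D"
proof -
  have "{path_distance G u v | u v. u \<in> verts G \<and> v \<in> verts G}
    = (\<lambda>(u, v). path_distance G u v) ` (verts G \<times> verts G)"
    by auto
  then have "finite {path_distance G u v | u v. u \<in> verts G \<and> v \<in> verts G}"
    by simp
  with assms show ?thesis
    unfolding has_diameter_def by (auto intro!: Max_ge)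
qed

text \<open>\<open>connected\<close> refers to the symmetric closure, which has the same
  reachability because the arcs are already symmetric.\<close>

lemma has_diameter_reachable:
  assumes "has_diameter G D" "u \<in> verts G" "v \<in> verts G"
  shows "u \<rightarrow>\<^sup>* v"
  using assms reachable_mk_symmetric_eq[OF sym_arcs, of u v]
  by (auto simp: has_diameter_def Digraph_Component.connected_def strongly_connected_def)

lemma nonbipartite_edge_sum:
  fixes x :: "'a \<Rightarrow> real"
  assumes nonbip: "\<not> bipartite_graph G" and D: "has_diameter G D"
    and w: "w \<in> verts G" "x w \<noteq> 0"
  shows "D > 0" "2 * (x w)\<^sup>2 < real D * (\<Sum>(u, v)\<in>arcs_ends G. (x u + x v)\<^sup>2)"
proof -
  let ?T = "\<Sum>(u, v)\<in>arcs_ends G. (x u + x v)\<^sup>2"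
  have reach: "w \<rightarrow>\<^sup>* v" if "v \<in> verts G" for v
    using has_diameter_reachable[OF D w(1) that] .
  from arc_within_layer[OF nonbip w(1) reach]
  obtain u v where uv: "u \<rightarrow> v" "path_distance G w u = path_distance G w v"
    by blast
  define k where "k = path_distance G w u"
  have verts: "u \<in> verts G" "v \<in> verts G"
    using uv(1) by auto
  have "u \<noteq> v"
    using uv(1) adj_not_same by blast
  from geodesic[OF reach[OF verts(1)] k_def[symmetric]]
  obtain f where f: "f 0 = w" "f k = u" "\<forall>i\<le>k. path_distance G w (f i) = i"
    "\<forall>i<k. f i \<rightarrow> f (Suc i)"
    by blast
  from geodesic[OF reach[OF verts(2)], of k]
  obtain g where g: "g 0 = w" "g k = v" "\<forall>i\<le>k. path_distance G w (g i) = i"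
    "\<forall>i<k. g i \<rightarrow> g (Suc i)"
    using uv(2) k_def by auto
  \<comment> \<open>For \<open>k = 0\<close> both ends would be \<open>w\<close>.\<close>
  have k: "k > 0"
    using f(1,2) g(1,2) \<open>u \<noteq> v\<close> by (cases k) auto
  have "k \<le> D"
    using path_distance_le_diameter[OF D w(1) verts(1)] k_def by simp
  with k show "D > 0" by simp
  have "finite (arcs_ends G)" "sym (arcs_ends G)"
    using sym_arcs by (auto simp: arcs_ends_def symmetric_def)
  then have bound: "8 * (x w)\<^sup>2 \<le> (4 * real k - 1) * ?T"
    using k f g uv(1) \<open>u \<noteq> v\<close>
    by (intro odd_walk_edge_sum[where f = f and g = g and l = "path_distance G w"]) auto
  \<comment> \<open>A nonzero \<open>x w\<close> forces \<open>?T\<close> to be positive, so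
    replacing \<open>4 * k - 1\<close> by \<open>4 * D\<close> is a strict increase.\<close>
  have "0 < (x w)\<^sup>2"
    using w(2) by simp
  with bound have "0 < (4 * real k - 1) * ?T"
    by linarith
  with k have "0 < ?T"
    by (simp add: zero_less_mult_iff)
  then have "(4 * real k - 1) * ?T < (4 * real D) * ?T"
    using \<open>k \<le> D\<close> by (intro mult_strict_right_mono) auto
  with bound show "2 * (x w)\<^sup>2 < real D * ?T"
    by simp
qed

section \<open>Eigenfunctions and the sum over edges\<close>

text \<open>The degree counts arcs and the matrix counts neighbours; they match because there are no
  parallel arcs.\<close>

lemma card_dominated:
  assumes "u \<in> verts G"
  shows "card {v \<in> verts G. u \<rightarrow> v} = out_degree G u"
proof -
  have "bij_betw (head G) (out_arcs G u) {v \<in> verts G. u \<rightarrow> v}"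
    unfolding bij_betw_def
  proof
    show "inj_on (head G) (out_arcs G u)"
      by (auto intro!: inj_onI no_multi_arcs simp: arc_to_ends_def)
  qed (auto simp: arcs_ends_conv)
  then show ?thesis
    by (simp add: out_degree_def bij_betw_same_card)
qed

text \<open>Twice the quadratic form of the signless Laplacian, \<open>d\<close> times the identity
  plus the adjacency matrix. On expanding the square, regularity evaluates the two pure sums and the
  eigenvalue equation the mixed one.\<close>

lemma edge_sum_eigenfunction:
  fixes x :: "'a \<Rightarrow> real"
  assumes reg: "\<And>v. v \<in> verts G \<Longrightarrow> out_degree G v = d"
    and eig: "\<And>u. u \<in> verts G \<Longrightarrow> (\<Sum>v\<in>{v \<in> verts G. u \<rightarrow> v}. x v) = c * x u"
  shows "(\<Sum>(u, v)\<in>arcs_ends G. (x u + x v)\<^sup>2) = 2 * (real d + c) * (\<Sum>v\<in>verts G. (x v)\<^sup>2)"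
proof -
  let ?N = "\<lambda>u. {v \<in> verts G. u \<rightarrow> v}"
  have arcs: "arcs_ends G = Sigma (verts G) ?N"
    by auto
  have iterated: "(\<Sum>(u, v)\<in>arcs_ends G. F u v) = (\<Sum>u\<in>verts G. \<Sum>v\<in>?N u. F u v)"
    for F :: "'a \<Rightarrow> 'a \<Rightarrow> real"
    using sum.Sigma[of "verts G" ?N F] by (simp flip: arcs)
  have swap: "(\<Sum>(u, v)\<in>arcs_ends G. (x v)\<^sup>2) = (\<Sum>(u, v)\<in>arcs_ends G. (x u)\<^sup>2)"
    using arcs_ends_symmetric[OF sym_arcs]
    by (intro sum.reindex_bij_witness[of _ prod.swap prod.swap]) auto
  have sq: "(\<Sum>(u, v)\<in>arcs_ends G. (x u)\<^sup>2) = real d * (\<Sum>v\<in>verts G. (x v)\<^sup>2)"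
    by (simp add: iterated card_dominated reg sum_distrib_left)
  have "(\<Sum>(u, v)\<in>arcs_ends G. x u * x v) = (\<Sum>u\<in>verts G. x u * (\<Sum>v\<in>?N u. x v))"
    by (simp add: iterated sum_distrib_left)
  also have "\<dots> = c * (\<Sum>v\<in>verts G. (x v)\<^sup>2)"
    by (simp add: eig sum_distrib_left power2_eq_square algebra_simps)
  finally have cross: "(\<Sum>(u, v)\<in>arcs_ends G. x u * x v) = c * (\<Sum>v\<in>verts G. (x v)\<^sup>2)" .
  have "(\<Sum>(u, v)\<in>arcs_ends G. (x u + x v)\<^sup>2)
    = (\<Sum>(u, v)\<in>arcs_ends G. (x u)\<^sup>2) + (\<Sum>(u, v)\<in>arcs_ends G. (x v)\<^sup>2)
      + 2 * (\<Sum>(u, v)\<in>arcs_ends G. x u * x v)"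
    unfolding sum_distrib_left sum.distrib[symmetric]
    by (intro sum.cong) (auto simp: power2_eq_square algebra_simps)
  also have "\<dots> = 2 * (real d + c) * (\<Sum>v\<in>verts G. (x v)\<^sup>2)"
    unfolding swap sq cross by (simp add: algebra_simps)
  finally show ?thesis .
qed

lemma nonbipartite_eigenfunction:
  fixes x :: "'a \<Rightarrow> real"
  assumes nonbip: "\<not> bipartite_graph G" and D: "has_diameter G D"
    and reg: "\<And>v. v \<in> verts G \<Longrightarrow> out_degree G v = d"
    and eig: "\<And>u. u \<in> verts G \<Longrightarrow> (\<Sum>v\<in>{v \<in> verts G. u \<rightarrow> v}. x v) = c * x u"
    and nz: "\<exists>v\<in>verts G. x v \<noteq> 0"
  shows "real d + c > 1 / (real (card (verts G)) * real D)"
proof -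
  let ?N = "\<Sum>v\<in>verts G. (x v)\<^sup>2"
  let ?n = "real (card (verts G))"
  from nz have ne: "verts G \<noteq> {}" by auto
  obtain w where w: "w \<in> verts G" "\<And>v. v \<in> verts G \<Longrightarrow> (x v)\<^sup>2 \<le> (x w)\<^sup>2"
  proof -
    have "Max ((\<lambda>v. (x v)\<^sup>2) ` verts G) \<in> (\<lambda>v. (x v)\<^sup>2) ` verts G"
      using ne by (intro Max_in) auto
    then obtain w where "w \<in> verts G" "Max ((\<lambda>v. (x v)\<^sup>2) ` verts G) = (x w)\<^sup>2"
      by blast
    then show thesis
      using that Max_ge[of "(\<lambda>v. (x v)\<^sup>2) ` verts G"] by force
  qed
  from nz w(2) have "x w \<noteq> 0"
    by force
  note sum = nonbipartite_edge_sum[of D w x, OF nonbip D w(1) this]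
  have "(x w)\<^sup>2 \<le> ?N"
    using w(1) by (intro member_le_sum) auto
  with \<open>x w \<noteq> 0\<close> have N: "0 < ?N"
    by (metis less_le_trans zero_less_power2)
  have n: "?n > 0"
    using ne by (simp add: card_gt_0_iff)
  have edges: "(\<Sum>(u, v)\<in>arcs_ends G. (x u + x v)\<^sup>2) = 2 * (real d + c) * ?N"
    using reg eig by (rule edge_sum_eigenfunction)
  have "real D * (2 * (real d + c) * ?N) = 2 * (real D * (real d + c) * ?N)"
    by (simp only: ac_simps)
  then have bound: "(x w)\<^sup>2 < real D * (real d + c) * ?N"
    using sum(2) unfolding edges by linarith
  \<comment> \<open>The maximality of \<open>x w\<close> enters here and brings in the factor
    \<open>n\<close>.\<close>
  have "?N \<le> ?n * (x w)\<^sup>2"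
    using sum_bounded_above[of "verts G" "\<lambda>v. (x v)\<^sup>2"] w(2) by simp
  also have "\<dots> < ?n * (real D * (real d + c) * ?N)"
    using bound n by (intro mult_strict_left_mono)
  finally have "1 * ?N < (?n * real D * (real d + c)) * ?N"
    by (simp add: mult.assoc)
  then have "1 < ?n * real D * (real d + c)"
    using N by (simp only: mult_less_cancel_right_pos)
  then show ?thesis
    using n sum(1) by (simp add: field_simps)
qed

end

section \<open>From the adjacency matrix to functions on vertices\<close>

lemma adjacency_matrix_mult_vec:
  assumes "vertex_enumeration G vs" "i < length vs"
  shows "(adjacency_matrix G vs *\<^sub>v vec (length vs) (\<lambda>j. x (vs ! j))) $ i
    = (\<Sum>v\<in>{v \<in> verts G. vs ! i \<rightarrow>\<^bsub>G\<^esub> v}. x v)"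
proof -
  have vs: "distinct vs" "set vs = verts G"
    using assms(1) by (auto simp: vertex_enumeration_def)
  then have fin: "finite (verts G)"
    by (metis List.finite_set)
  have bij: "bij_betw ((!) vs) {0..<length vs} (verts G)"
    using bij_betw_nth[OF vs(1), of "{0..<length vs}" "verts G"] vs(2)
    by (simp add: atLeast0LessThan)
  have "(adjacency_matrix G vs *\<^sub>v vec (length vs) (\<lambda>j. x (vs ! j))) $ i
    = (\<Sum>j\<in>{0..<length vs}. (if vs ! i \<rightarrow>\<^bsub>G\<^esub> vs ! j then x (vs ! j) else 0))"
    using assms(2) by (auto simp: adjacency_matrix_def scalar_prod_def intro!: sum.cong)
  also have "\<dots> = (\<Sum>v\<in>verts G. if vs ! i \<rightarrow>\<^bsub>G\<^esub> v then x v else 0)"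
    by (rule sum.reindex_bij_betw[OF bij])
  also have "\<dots> = (\<Sum>v\<in>{v \<in> verts G. vs ! i \<rightarrow>\<^bsub>G\<^esub> v}. x v)"
    using fin by (simp add: sum.If_cases Collect_conj_eq)
  finally show ?thesis .
qed

text \<open>The right side does not mention \<open>vs\<close>, so the rest of the argument can work
  with functions on vertices instead of indexed vectors.\<close>

lemma adjacency_matrix_eigenvalue_iff:
  assumes "vertex_enumeration G vs"
  shows "eigenvalue (adjacency_matrix G vs) c \<longleftrightarrow>
    (\<exists>x. (\<exists>v\<in>verts G. x v \<noteq> 0) \<and>
      (\<forall>u\<in>verts G. (\<Sum>v\<in>{v \<in> verts G. u \<rightarrow>\<^bsub>G\<^esub> v}. x v) = c * x u))"
proof -
  let ?A = "adjacency_matrix G vs" and ?n = "length vs"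
  have vs: "distinct vs" "set vs = verts G"
    using assms by (auto simp: vertex_enumeration_def)
  have dim: "dim_row ?A = ?n"
    by (simp add: adjacency_matrix_def)
  have vec_iff: "eigenvector ?A (vec ?n (\<lambda>j. x (vs ! j))) c \<longleftrightarrow>
    (\<exists>v\<in>verts G. x v \<noteq> 0) \<and>
    (\<forall>u\<in>verts G. (\<Sum>v\<in>{v \<in> verts G. u \<rightarrow>\<^bsub>G\<^esub> v}. x v) = c * x u)" for x
  proof -
    have ex: "(\<exists>v\<in>set vs. x v \<noteq> 0) \<longleftrightarrow> (\<exists>i<?n. x (vs ! i) \<noteq> 0)"
      by (force simp: in_set_conv_nth)
    have "eigenvector ?A (vec ?n (\<lambda>j. x (vs ! j))) c \<longleftrightarrow>
      (\<exists>i<?n. x (vs ! i) \<noteq> 0) \<and>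
      (\<forall>i<?n. (\<Sum>v\<in>{v \<in> verts G. vs ! i \<rightarrow>\<^bsub>G\<^esub> v}. x v) = c * x (vs ! i))"
      using adjacency_matrix_mult_vec[OF assms, of _ x]
      by (simp add: eigenvector_def vec_eq_iff dim del: index_mult_mat_vec)
    also have "\<dots> \<longleftrightarrow> (\<exists>v\<in>set vs. x v \<noteq> 0) \<and>
      (\<forall>u\<in>set vs. (\<Sum>v\<in>{v \<in> verts G. u \<rightarrow>\<^bsub>G\<^esub> v}. x v) = c * x u)"
      unfolding all_set_conv_all_nth using ex by simp
    finally show ?thesis
      unfolding vs(2) .
  qed
  \<comment> \<open>As \<open>vs\<close> has no repetitions, a vertex determines its index, and
    every vector comes from a function on vertices.\<close>
  have "\<exists>x. y = vec ?n (\<lambda>j. x (vs ! j))" if "y \<in> carrier_vec ?n" for y :: "real vec"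
  proof
    show "y = vec ?n (\<lambda>j. y $ the_inv_into {..<?n} ((!) vs) (vs ! j))"
      using that vs(1) by (auto simp: the_inv_into_f_f inj_on_nth)
  qed
  then have "eigenvalue ?A c \<longleftrightarrow> (\<exists>x. eigenvector ?A (vec ?n (\<lambda>j. x (vs ! j))) c)"
    unfolding eigenvalue_def by (metis dim eigenvector_def)
  then show ?thesis
    by (simp add: vec_iff)
qed

theorem theorem2:
  fixes G :: "('a, 'b) pre_digraph" and vs :: "'a list" and n D :: nat
  assumes "graph G"
    and "regular_graph G"
    and "\<not> bipartite_graph G"
    and "card (verts G) = n"
    and "has_diameter G D"
    and "vertex_enumeration G vs"
  shows "max_eigenvalue (adjacency_matrix G vs) + min_eigenvalue (adjacency_matrix G vs)
    > 1 / (real n * real D)"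
proof -
  interpret graph G by fact
  let ?A = "adjacency_matrix G vs"
  note eigenvalue_iff = adjacency_matrix_eigenvalue_iff[OF assms(6)]
  obtain d where d: "\<And>v. v \<in> verts G \<Longrightarrow> out_degree G v = d"
    using assms(2) by (auto simp: regular_graph_def)
  have ne: "verts G \<noteq> {}"
    using assms(5) by (auto simp: has_diameter_def Digraph_Component.connected_def strongly_connected_def)
  \<comment> \<open>By regularity the constant function 1 is an eigenfunction, so
    \<open>max_eigenvalue\<close> is at least \<open>d\<close>.\<close>
  have "eigenvalue ?A (real d)"
    unfolding eigenvalue_iff using ne by (intro exI[of _ "\<lambda>_. 1"]) (auto simp: card_dominated d)
  then have d_in: "real d \<in> spectrum ?A"
    by (simp add: spectrum_def)
  \<comment> \<open>The spectrum is finite and contains \<open>d\<close>, so \<open>Max\<close> and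
    \<open>Min\<close> are attained in it.\<close>
  have "finite (spectrum ?A)"
    by (rule card_finite_spectrum(1)[of _ "length vs"]) (simp add: adjacency_matrix_def)
  with d_in have max: "real d \<le> max_eigenvalue ?A" and "min_eigenvalue ?A \<in> spectrum ?A"
    by (auto simp: max_eigenvalue_def min_eigenvalue_def intro: Max_ge Min_in)
  then have "eigenvalue ?A (min_eigenvalue ?A)"
    by (simp add: spectrum_def)
  then obtain x where "\<exists>v\<in>verts G. x v \<noteq> 0"
    "\<And>u. u \<in> verts G \<Longrightarrow> (\<Sum>v\<in>{v \<in> verts G. u \<rightarrow>\<^bsub>G\<^esub> v}. x v) = min_eigenvalue ?A * x u"
    unfolding eigenvalue_iff by blast
  then have "real d + min_eigenvalue ?A > 1 / (real (card (verts G)) * real D)"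
    using d by (intro nonbipartite_eigenfunction[OF assms(3,5)])
  with max assms(4) show ?thesis by simp
qed

end
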